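(* Let $p\in(0,1)$, and let $G$ and $H$ be two independent Erdős–Rényi graphs $G(n,p)$. For a positive integer $k$ let $Z_k$ be the number of $k$-cliques in $G\times H$. Then there exists a non-negative sequence $(a_n)$ with $a_n=o(1)$ such that $k_*=k_{*,n}=(2-a_n)\log_{1/p} n$ is a positive integer and $$\mathbb{P}(Z_{k_*}>0)\to 1\quad\text{as } n\to\infty.$$
   Context: An Erdős–Rényi graph $G(n,p)$ is a random simple graph on vertex set $\{1,\dots,n\}$ in which each of the $\binom{n}{2}$ possible edges is present independently with probability $p$. A $k$-clique is a set of $k$ pairwise adjacent vertices. The tensor product $G\times H$ of graphs $G=(V_1,E_1)$, $H=(V_2,E_2)$ has vertex set $V_1\times V_2$, with $(v_1,v_2)$ adjacent to $(v_1',v_2')$ if and only if $v_1v_1'\in E_1$ and $v_2v_2'\in E_2$. *)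

theory Defs
  imports "HOL-Probability.Probability" "HOL-Library.Landau_Symbols"
begin

text \<open>A graph is a vertex set together with a set of edges; the edges of a simple graph are
  two-element subsets of the vertex set.\<close>

record 'a ugraph =
  vertices :: "'a set"
  edges :: "'a set set"

definition possible_edges :: "'a set \<Rightarrow> 'a set set" where
  "possible_edges V = {e. e \<subseteq> V \<and> card e = 2}"

definition simple_graph :: "'a ugraph \<Rightarrow> bool" where
  "simple_graph G \<longleftrightarrow> edges G \<subseteq> possible_edges (vertices G)"

definition adjacent :: "'a ugraph \<Rightarrow> 'a \<Rightarrow> 'a \<Rightarrow> bool" where
  "adjacent G u v \<longleftrightarrow> {u, v} \<in> edges G"

definition cliques :: "'a ugraph \<Rightarrow> nat \<Rightarrow> 'a set set" where
  "cliques G k = {S. finite S \<and> S \<subseteq> vertices G \<and> card S = k \<and>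
     (\<forall>u\<in>S. \<forall>v\<in>S. u \<noteq> v \<longrightarrow> adjacent G u v)}"

definition tensor_product :: "'a ugraph \<Rightarrow> 'b ugraph \<Rightarrow> ('a \<times> 'b) ugraph" where
  "tensor_product G H =
     \<lparr>vertices = vertices G \<times> vertices H,
      edges = {{(u, x), (v, y)} | u v x y. adjacent G u v \<and> adjacent H x y}\<rparr>"

text \<open>The Pi_pmf below is the law of independent Bernoulli(p) edge indicators, one for each
  possible edge. Outside the finite set of possible edges the indicators take the dummy value
  False, which is never inspected.\<close>

definition erdos_renyi :: "nat \<Rightarrow> real \<Rightarrow> nat ugraph pmf" where
  "erdos_renyi n p =
     map_pmf (\<lambda>present. \<lparr>vertices = {1..n}, edges = {e \<in> possible_edges {1..n}. present e}\<rparr>)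
       (Pi_pmf (possible_edges {1..n}) False (\<lambda>_. bernoulli_pmf p))"

lemma adjacent_tensor_product:
  "adjacent (tensor_product G H) (u, x) (v, y) \<longleftrightarrow> adjacent G u v \<and> adjacent H x y"
  unfolding adjacent_def tensor_product_def
  by (auto simp: doubleton_eq_iff insert_commute adjacent_def)

lemma simple_graph_tensor_product:
  assumes "simple_graph G" "simple_graph H"
  shows "simple_graph (tensor_product G H)"
  using assms unfolding simple_graph_def tensor_product_def possible_edges_def adjacent_def
  by (fastforce simp: card_2_iff doubleton_eq_iff)

lemma simple_graph_erdos_renyi:
  "G \<in> set_pmf (erdos_renyi n p) \<Longrightarrow> simple_graph G \<and> vertices G = {1..n}"
  unfolding erdos_renyi_def simple_graph_def by auto

end

theory Submission
  imports Defs "HOL-Real_Asymp.Real_Asymp"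
begin

text \<open>Pairing up the vertices of a \<open>k\<close>-clique of \<open>G\<close> with those of a \<open>k\<close>-clique of \<open>H\<close> along any
  bijection gives a \<open>k\<close>-clique of \<open>G \<times> H\<close>, so by independence it suffices that \<open>G(n,p)\<close> has a
  \<open>k\<close>-clique with probability tending to 1. This is the second moment method: the number \<open>Z\<close> of
  \<open>k\<close>-cliques satisfies \<open>E[Z\<^sup>2] / E[Z]\<^sup>2 \<le> (1 + x)^k \<le> exp (k x)\<close> with
  \<open>x = k (1/p)^(k/2) / n\<close>. Writing \<open>L\<close> for the logarithm of \<open>n\<close> in base \<open>1/p\<close>, the choice
  \<open>k = \<lfloor>2 L - sqrt L\<rfloor>\<close> makes \<open>k x\<close> of order at most \<open>L\<^sup>2 (1/p)^(-sqrt L / 2)\<close>, which tends to 0.\<close>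

section \<open>Independence and the second moment bound\<close>

lemma prob_pair_pmf_Times:
  "measure_pmf.prob (pair_pmf M N) (A \<times> B) = measure_pmf.prob M A * measure_pmf.prob N B"
proof -
  have "emeasure (pair_pmf M N) (A \<times> B) = (\<integral>\<^sup>+z. indicator (A \<times> B) z \<partial>pair_pmf M N)"
    by simp
  also have "\<dots> = (\<integral>\<^sup>+x. \<integral>\<^sup>+y. indicator A x * indicator B y \<partial>N \<partial>M)"
    by (simp add: nn_integral_pair_pmf' indicator_times)
  also have "\<dots> = emeasure M A * emeasure N B"
    by (simp add: nn_integral_cmult nn_integral_multc)
  finally show ?thesis
    by (simp add: measure_pmf.emeasure_eq_measure flip: ennreal_mult)
qed

text \<open>Chebyshev's inequality for the number \<open>X\<close> of events that occur: if none
  occurs, \<open>X\<close> is 0 and lies \<open>\<mu> I\<close> away from its mean. Variance over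
  squared mean is E[X^2]/E[X]^2 - 1, whence the constant 2.\<close>

lemma second_moment_bound:
  fixes M :: "'a pmf" and A :: "'i \<Rightarrow> 'a set"
  defines "\<mu> \<equiv> \<lambda>I. \<Sum>i\<in>I. measure_pmf.prob M (A i)"
  assumes I: "finite I" and pos: "\<mu> I > 0"
  shows "2 - (\<Sum>i\<in>I. \<Sum>j\<in>I. measure_pmf.prob M (A i \<inter> A j)) / (\<mu> I)\<^sup>2
          \<le> measure_pmf.prob M (\<Union>i\<in>I. A i)"
proof -
  define X :: "'a \<Rightarrow> real" where "X = (\<lambda>x. \<Sum>i\<in>I. indicator (A i) x)"
  let ?E2 = "\<Sum>i\<in>I. \<Sum>j\<in>I. measure_pmf.prob M (A i \<inter> A j)"
  have int_ind: "integrable (measure_pmf M) (indicator B :: 'a \<Rightarrow> real)" for B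
    by (rule measure_pmf.integrable_const_bound[where B = 1]) (auto simp: indicator_def)
  have X2: "(X x)\<^sup>2 = (\<Sum>i\<in>I. \<Sum>j\<in>I. indicator (A i \<inter> A j) x)" for x
    by (simp add: X_def power2_eq_square sum_product indicator_inter_arith)
  have EX: "measure_pmf.expectation M X = \<mu> I"
    unfolding X_def \<mu>_def by (subst Bochner_Integration.integral_sum) (auto intro: int_ind)
  have EX2: "measure_pmf.expectation M (\<lambda>x. (X x)\<^sup>2) = ?E2"
    unfolding X2 by (simp add: Bochner_Integration.integral_sum int_ind)
  have intX: "integrable (measure_pmf M) X"
    unfolding X_def by (intro Bochner_Integration.integrable_sum int_ind)
  have intX2: "integrable (measure_pmf M) (\<lambda>x. (X x)\<^sup>2)"
    unfolding X2 by (intro Bochner_Integration.integrable_sum int_ind)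
  have "measure_pmf.prob M (- (\<Union>i\<in>I. A i))
      \<le> measure_pmf.prob M {x \<in> space M. \<bar>X x - measure_pmf.expectation M X\<bar> \<ge> \<mu> I}"
    unfolding EX using pos by (intro measure_pmf.finite_measure_mono) (auto simp: X_def)
  also have "\<dots> \<le> measure_pmf.variance M X / (\<mu> I)\<^sup>2"
    by (rule measure_pmf.Chebyshev_inequality) (use intX2 pos in auto)
  also have "\<dots> = (?E2 - (\<mu> I)\<^sup>2) / (\<mu> I)\<^sup>2"
    using measure_pmf.variance_eq[OF intX intX2] by (simp only: EX EX2)
  also have "\<dots> = ?E2 / (\<mu> I)\<^sup>2 - 1"
    using pos by (simp add: field_simps)
  finally show ?thesis
    using measure_pmf.prob_compl[of "\<Union>i\<in>I. A i" M] by (simp add: Compl_eq_Diff_UNIV)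
qed

section \<open>Edge sets and cliques\<close>

lemma card_possible_edges: "finite V \<Longrightarrow> card (possible_edges V) = card V choose 2"
  unfolding possible_edges_def by (rule n_subsets)

lemma finite_possible_edges: "finite V \<Longrightarrow> finite (possible_edges V)"
  unfolding possible_edges_def by (rule finite_subset[of _ "Pow V"]) auto

lemma possible_edges_mono: "S \<subseteq> V \<Longrightarrow> possible_edges S \<subseteq> possible_edges V"
  unfolding possible_edges_def by auto

lemma possible_edges_Int: "possible_edges S \<inter> possible_edges T = possible_edges (S \<inter> T)"
  unfolding possible_edges_def by auto

text \<open>In this form, being a clique is the inclusion of a fixed edge set, the kind of event
  whose probability in G(n,p) is a power of \<open>p\<close>.\<close>

lemma cliques_eq:
  "cliques G k = {S. finite S \<and> S \<subseteq> vertices G \<and> card S = k \<and> possible_edges S \<subseteq> edges G}"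
proof -
  have "(\<forall>u\<in>S. \<forall>v\<in>S. u \<noteq> v \<longrightarrow> adjacent G u v) \<longleftrightarrow> possible_edges S \<subseteq> edges G" for S
  proof
    assume *: "\<forall>u\<in>S. \<forall>v\<in>S. u \<noteq> v \<longrightarrow> adjacent G u v"
    show "possible_edges S \<subseteq> edges G"
    proof
      fix e assume "e \<in> possible_edges S"
      then obtain u v where "e = {u, v}" "u \<noteq> v" "e \<subseteq> S"
        unfolding possible_edges_def card_2_iff by blast
      then show "e \<in> edges G"
        using * unfolding adjacent_def by simp
    qed
  next
    assume sub: "possible_edges S \<subseteq> edges G"
    show "\<forall>u\<in>S. \<forall>v\<in>S. u \<noteq> v \<longrightarrow> adjacent G u v"
    proof (intro ballI impI)
      fix u v assume "u \<in> S" "v \<in> S" "u \<noteq> v"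
      then have "{u, v} \<in> possible_edges S"
        by (simp add: possible_edges_def)
      with sub show "adjacent G u v"
        unfolding adjacent_def by blast
    qed
  qed
  then show ?thesis
    unfolding cliques_def by simp
qed

lemma cliques_tensor_product_nonempty:
  assumes "cliques G k \<noteq> {}" "cliques H k \<noteq> {}"
  shows "cliques (tensor_product G H) k \<noteq> {}"
proof -
  obtain S T where S: "finite S" "S \<subseteq> vertices G" "card S = k"
      "\<And>u v. u \<in> S \<Longrightarrow> v \<in> S \<Longrightarrow> u \<noteq> v \<Longrightarrow> adjacent G u v"
    and T: "finite T" "T \<subseteq> vertices H" "card T = k"
      "\<And>x y. x \<in> T \<Longrightarrow> y \<in> T \<Longrightarrow> x \<noteq> y \<Longrightarrow> adjacent H x y"
    using assms unfolding cliques_def ex_in_conv[symmetric] mem_Collect_eq by metis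
  then obtain f where f: "bij_betw f S T"
    using finite_same_card_bij[of S T] by auto
  \<comment> \<open>The graph of \<open>f\<close>. Its distinct points differ in both coordinates
    because \<open>f\<close> is injective, so both cliques supply the adjacency required.\<close>
  let ?C = "(\<lambda>u. (u, f u)) ` S"
  have "adjacent (tensor_product G H) (u, f u) (v, f v)" if "u \<in> S" "v \<in> S" "u \<noteq> v" for u v
  proof -
    have "f u \<in> T" "f v \<in> T" "f u \<noteq> f v"
      using that f by (auto simp: bij_betw_def inj_on_def)
    then show ?thesis
      unfolding adjacent_tensor_product using S(4) T(4) that by blast
  qed
  moreover have "?C \<subseteq> vertices (tensor_product G H)"
    using S(2) T(2) bij_betwE[OF f] by (auto simp: tensor_product_def)
  moreover have "card ?C = k"
    using S(3) by (simp add: card_image inj_on_def)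
  ultimately have "?C \<in> cliques (tensor_product G H) k"
    using S(1) unfolding cliques_def by blast
  then show ?thesis by blast
qed

section \<open>Probability that prescribed edges are present\<close>

lemma prob_erdos_renyi_edges_subset:
  assumes p: "0 \<le> p" "p \<le> 1" and F: "F \<subseteq> possible_edges {1..n}"
  shows "measure_pmf.prob (erdos_renyi n p) {G. F \<subseteq> edges G} = p ^ card F"
proof -
  let ?E = "possible_edges {1..n}"
  \<comment> \<open>The event is a box: coordinates in \<open>F\<close> are forced to be
    \<open>True\<close>, the others are free, so the product measure factorises.\<close>
  let ?B = "\<lambda>e. if e \<in> F then {True} else UNIV"
  have fin: "finite ?E"
    by (rule finite_possible_edges) simp
  have "measure_pmf.prob (erdos_renyi n p) {G. F \<subseteq> edges G}
      = measure_pmf.prob (Pi_pmf ?E False (\<lambda>_. bernoulli_pmf p)) (Pi ?E ?B)"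
    unfolding erdos_renyi_def measure_map_pmf
    by (rule arg_cong[where f = "measure_pmf.prob _"]) (use F in \<open>auto simp: Pi_def split: if_splits\<close>)
  also have "\<dots> = (\<Prod>e\<in>?E. measure_pmf.prob (bernoulli_pmf p) (?B e))"
    by (rule measure_Pi_pmf_Pi[OF fin])
  also have "\<dots> = (\<Prod>e\<in>?E. if e \<in> F then p else 1)"
    using p by (intro prod.cong refl) (auto simp: measure_pmf_single)
  also have "\<dots> = p ^ card F"
    using fin F by (simp add: prod.If_cases Int_absorb1)
  finally show ?thesis .
qed

section \<open>Counting supersets and binomial estimates\<close>

lemma card_supersets:
  assumes V: "finite V" and J: "J \<subseteq> V" "card J \<le> k"
  shows "card {T. J \<subseteq> T \<and> T \<subseteq> V \<and> card T = k} = (card V - card J) choose (k - card J)"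
proof -
  have fJ: "finite J"
    using J V finite_subset by blast
  have "bij_betw (\<lambda>T. T - J) {T. J \<subseteq> T \<and> T \<subseteq> V \<and> card T = k}
          {U. U \<subseteq> V - J \<and> card U = k - card J}"
  proof (rule bij_betw_byWitness[where f' = "\<lambda>U. U \<union> J"])
    show "(\<lambda>U. U \<union> J) ` {U. U \<subseteq> V - J \<and> card U = k - card J} \<subseteq> {T. J \<subseteq> T \<and> T \<subseteq> V \<and> card T = k}"
    proof (clarsimp, intro conjI)
      fix U assume U: "U \<subseteq> V - J" "card U = k - card J"
      then have "finite U" using V by (meson finite_Diff finite_subset)
      then show "card (U \<union> J) = k"
        using U fJ J by (subst card_Un_disjoint) auto
    qed (use J in auto)
  qed (use J fJ in \<open>auto simp: card_Diff_subset\<close>)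
  then have "card {T. J \<subseteq> T \<and> T \<subseteq> V \<and> card T = k} = card {U. U \<subseteq> V - J \<and> card U = k - card J}"
    by (rule bij_betw_same_card)
  also have "\<dots> = card (V - J) choose (k - card J)"
    using V by (intro n_subsets) auto
  finally show ?thesis
    using J fJ by (simp add: card_Diff_subset)
qed

text \<open>By the absorption identity, raising \<open>j\<close> by one multiplies the left side by
  \<open>(k - j) / (n - j)\<close>, which is at most \<open>k / n\<close> since
  \<open>k \<le> n\<close>.\<close>

lemma binomial_diff_diff_le:
  assumes "j \<le> k" "k \<le> n"
  shows "real ((n - j) choose (k - j)) \<le> real (n choose k) * (real k / real n) ^ j"
  using assms(1)
proof (induction j)
  case 0
  then show ?case by simp
next
  case (Suc j)
  have "(k - j) * ((n - j) choose (k - j)) = (n - j) * ((n - Suc j) choose (k - Suc j))"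
    using Suc.prems times_binomial_minus1_eq[of "k - j" "n - j"] by simp
  then have "real (k - j) * real ((n - j) choose (k - j)) = real (n - j) * real ((n - Suc j) choose (k - Suc j))"
    by (metis of_nat_mult)
  then have "real ((n - Suc j) choose (k - Suc j)) = real ((n - j) choose (k - j)) * (real (k - j) / real (n - j))"
    using Suc.prems assms by (simp add: field_simps)
  also have "\<dots> \<le> (real (n choose k) * (real k / real n) ^ j) * (real k / real n)"
  proof (intro mult_mono)
    have "real j * real k \<le> real j * real n"
      using assms by (intro mult_left_mono) auto
    then show "real (k - j) / real (n - j) \<le> real k / real n"
      using Suc.prems assms by (simp add: of_nat_diff divide_simps) (simp add: algebra_simps)
  qed (use Suc in auto)
  finally show ?case
    by (simp add: mult_ac)
qed

text \<open>Expand the product of \<open>1 + x\<close> over the elements of \<open>S\<close>: the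
  subset \<open>J\<close> records the factors from which \<open>x\<close> is taken.\<close>

lemma sum_Pow_power_card:
  fixes x :: real
  assumes "finite S"
  shows "(\<Sum>J\<in>Pow S. x ^ card J) = (1 + x) ^ card S"
  using prod_add[OF assms, of "\<lambda>_. x" "\<lambda>_. 1"] by (simp add: add.commute)

text \<open>Bounding \<open>c\<close> to the power \<open>\<bar>S \<inter> T\<bar> choose 2\<close> by the sum of the same quantity over all subsets
  \<open>J\<close> of \<open>S \<inter> T\<close> makes the sum over \<open>T\<close> a mere count of the supersets of \<open>J\<close>.\<close>

lemma sum_power_choose_Int_le:
  fixes s :: real
  assumes s: "1 \<le> s" and V: "finite V" and S: "S \<subseteq> V" "card S = k"
  shows "(\<Sum>T | T \<subseteq> V \<and> card T = k. (s\<^sup>2) ^ (card (S \<inter> T) choose 2))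
    \<le> real (card V choose k) * (1 + s ^ k * real k / real (card V)) ^ k"
proof -
  let ?I = "{T. T \<subseteq> V \<and> card T = k}"
  let ?n = "card V"
  have fI: "finite ?I"
    using V by (auto intro: finite_subset[of _ "Pow V"])
  have fS: "finite S"
    using S V finite_subset by blast
  have kn: "k \<le> ?n"
    using S V card_mono by blast
  \<comment> \<open>The quadratic exponent is traded for one linear in \<open>j\<close>, via
    \<open>2 * (j choose 2) = j * (j - 1) \<le> k * j\<close>. Writing the base as a square lets
    \<open>s ^ k\<close> play the role of its power k/2 without fractional exponents.\<close>
  have pow: "(s\<^sup>2) ^ (j choose 2) \<le> (s ^ k) ^ j" if "j \<le> k" for j
  proof -
    have "2 * (j choose 2) = j * (j - 1)"
      unfolding choose_two by (rule dvd_mult_div_cancel) auto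
    also have "\<dots> \<le> k * j"
      unfolding mult.commute[of k] by (rule mult_le_mono2) (use that in linarith)
    finally show ?thesis
      using s unfolding power_mult[symmetric] by (intro power_increasing) auto
  qed
  have "(\<Sum>T\<in>?I. (s\<^sup>2) ^ (card (S \<inter> T) choose 2))
      \<le> (\<Sum>T\<in>?I. \<Sum>J\<in>{J\<in>Pow S. J \<subseteq> T}. (s\<^sup>2) ^ (card J choose 2))"
  proof (rule sum_mono)
    fix T
    show "(s\<^sup>2) ^ (card (S \<inter> T) choose 2) \<le> (\<Sum>J\<in>{J\<in>Pow S. J \<subseteq> T}. (s\<^sup>2) ^ (card J choose 2))"
      by (rule member_le_sum) (use fS s in auto)
  qed
  also have "\<dots> = (\<Sum>J\<in>Pow S. \<Sum>T\<in>{T\<in>?I. J \<subseteq> T}. (s\<^sup>2) ^ (card J choose 2))"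
    using fI fS by (intro sum.swap_restrict) auto
  also have "\<dots> = (\<Sum>J\<in>Pow S. real ((?n - card J) choose (k - card J)) * (s\<^sup>2) ^ (card J choose 2))"
  proof (rule sum.cong[OF refl])
    fix J assume J: "J \<in> Pow S"
    have "{T\<in>?I. J \<subseteq> T} = {T. J \<subseteq> T \<and> T \<subseteq> V \<and> card T = k}" by auto
    moreover have "card J \<le> k"
      using J S fS card_mono by blast
    ultimately have "card {T\<in>?I. J \<subseteq> T} = (?n - card J) choose (k - card J)"
      using card_supersets[OF V] J S by auto
    then show "(\<Sum>T\<in>{T\<in>?I. J \<subseteq> T}. (s\<^sup>2) ^ (card J choose 2))
        = real ((?n - card J) choose (k - card J)) * (s\<^sup>2) ^ (card J choose 2)"
      by simp
  qed
  \<comment> \<open>Both factors are now bounded by powers with exponent \<open>card J\<close>;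
    merged into a single power, they can be summed over all subsets of \<open>S\<close> in closed
    form.\<close>
  also have "\<dots> \<le> (\<Sum>J\<in>Pow S. real (?n choose k) * (s ^ k * real k / real ?n) ^ card J)"
  proof (rule sum_mono)
    fix J assume "J \<in> Pow S"
    then have j: "card J \<le> k"
      using S fS card_mono by blast
    have "real ((?n - card J) choose (k - card J)) * (s\<^sup>2) ^ (card J choose 2)
        \<le> (real (?n choose k) * (real k / real ?n) ^ card J) * (s ^ k) ^ card J"
      using binomial_diff_diff_le[OF j kn] pow[OF j] s by (intro mult_mono) auto
    also have "\<dots> = real (?n choose k) * (s ^ k * real k / real ?n) ^ card J"
      by (simp add: power_mult_distrib power_divide)
    finally show "real ((?n - card J) choose (k - card J)) * (s\<^sup>2) ^ (card J choose 2)
        \<le> real (?n choose k) * (s ^ k * real k / real ?n) ^ card J" .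
  qed
  also have "\<dots> = real (?n choose k) * (1 + s ^ k * real k / real ?n) ^ k"
    using sum_Pow_power_card[OF fS] S by (simp flip: sum_distrib_left)
  finally show ?thesis .
qed

section \<open>Cliques in one random graph and in the product\<close>

text \<open>The second moment bound for the events that a given \<open>k\<close>-set spans a clique.
  Finiteness of the vertex set is kept in the event because \<open>card\<close> is 0 on infinite
  sets: a positive clique count in the product needs finitely many cliques.\<close>

lemma prob_erdos_renyi_clique_ge:
  assumes p: "0 < p" "p < 1" and k: "k \<le> n"
  shows "2 - (1 + sqrt (1 / p) ^ k * real k / real n) ^ k
    \<le> measure_pmf.prob (erdos_renyi n p) {G. finite (vertices G) \<and> cliques G k \<noteq> {}}"
proof -
  let ?M = "erdos_renyi n p"
  let ?I = "{S. S \<subseteq> {1..n} \<and> card S = k}"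
  define A :: "nat set \<Rightarrow> nat ugraph set" where "A = (\<lambda>S. {G. possible_edges S \<subseteq> edges G})"
  let ?\<mu> = "\<Sum>S\<in>?I. measure_pmf.prob ?M (A S)"
  let ?r = "(1 + sqrt (1 / p) ^ k * real k / real n) ^ k"
  define q where "q = p ^ (k choose 2)"
  have q: "q > 0"
    using p by (simp add: q_def)
  have fI: "finite ?I"
    by (auto intro: finite_subset[of _ "Pow {1..n}"])
  have cI: "card ?I = n choose k"
    using n_subsets[of "{1..n}" k] by simp
  have fin: "finite S" if "S \<in> ?I" for S
    using that finite_subset by blast
  have probA: "measure_pmf.prob ?M (A S) = q" if "S \<in> ?I" for S
    using that p fin[OF that] unfolding A_def
    by (subst prob_erdos_renyi_edges_subset)
       (auto simp: card_possible_edges q_def intro: possible_edges_mono[THEN subsetD])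
  \<comment> \<open>The pairs inside \<open>S \<inter> T\<close> are counted twice in
    \<open>2 * (k choose 2)\<close>. Each saves one factor \<open>p\<close> compared with
    independent events, hence a factor \<open>1 / p\<close>, written as a square to match
    \<open>sum_power_choose_Int_le\<close>.\<close>
  have probAA: "measure_pmf.prob ?M (A S \<inter> A T) = q\<^sup>2 * ((sqrt (1 / p))\<^sup>2) ^ (card (S \<inter> T) choose 2)"
    if S: "S \<in> ?I" and T: "T \<in> ?I" for S T
  proof -
    let ?F = "possible_edges S \<union> possible_edges T"
    have "card ?F + (card (S \<inter> T) choose 2) = 2 * (k choose 2)"
      using card_Un_Int[of "possible_edges S" "possible_edges T"] S T fin[OF S] fin[OF T]
      by (simp add: possible_edges_Int finite_possible_edges card_possible_edges)
    then have "p ^ card ?F * p ^ (card (S \<inter> T) choose 2) = q\<^sup>2"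
      unfolding q_def by (metis power_add power_mult mult.commute)
    then have "p ^ card ?F = q\<^sup>2 * (1 / p) ^ (card (S \<inter> T) choose 2)"
      using p by (simp add: power_divide field_simps)
    moreover have "measure_pmf.prob ?M (A S \<inter> A T) = p ^ card ?F"
    proof -
      have "A S \<inter> A T = {G. ?F \<subseteq> edges G}"
        by (auto simp: A_def)
      moreover have "?F \<subseteq> possible_edges {1..n}"
        using S T possible_edges_mono by blast
      ultimately show ?thesis
        using p by (simp only: prob_erdos_renyi_edges_subset)
    qed
    ultimately show ?thesis
      using p by simp
  qed
  have \<mu>: "?\<mu> = real (n choose k) * q"
    using probA cI by simp
  then have \<mu>_pos: "?\<mu> > 0"
    using q k by simp
  have "(\<Sum>S\<in>?I. \<Sum>T\<in>?I. measure_pmf.prob ?M (A S \<inter> A T))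
      = (\<Sum>S\<in>?I. q\<^sup>2 * (\<Sum>T\<in>?I. ((sqrt (1 / p))\<^sup>2) ^ (card (S \<inter> T) choose 2)))"
    unfolding sum_distrib_left by (intro sum.cong refl probAA)
  \<comment> \<open>The bound on the inner sum is the same for all \<open>S\<close>, so the outer
    sum contributes a second \<open>n choose k\<close> and completes the squared mean.\<close>
  also have "\<dots> \<le> (\<Sum>S\<in>?I. q\<^sup>2 * (real (n choose k) * ?r))"
  proof (intro sum_mono mult_left_mono)
    fix S assume "S \<in> ?I"
    then show "(\<Sum>T\<in>?I. ((sqrt (1 / p))\<^sup>2) ^ (card (S \<inter> T) choose 2)) \<le> real (n choose k) * ?r"
      using sum_power_choose_Int_le[of "sqrt (1 / p)" "{1..n}" S k] p by simp
  qed simp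
  also have "\<dots> = ?\<mu>\<^sup>2 * ?r"
    unfolding \<mu> using cI by (simp add: power2_eq_square)
  finally have "(\<Sum>S\<in>?I. \<Sum>T\<in>?I. measure_pmf.prob ?M (A S \<inter> A T)) / ?\<mu>\<^sup>2 \<le> ?r"
    using \<mu>_pos by (simp add: divide_le_eq mult.commute)
  then have "2 - ?r \<le> measure_pmf.prob ?M (\<Union>S\<in>?I. A S)"
    using second_moment_bound[OF fI \<mu>_pos] by linarith
  \<comment> \<open>The events \<open>A S\<close> constrain only edges; on the support the vertex
    set is known to be \<open>{1..n}\<close>.\<close>
  also have "\<dots> = measure_pmf.prob ?M ((\<Union>S\<in>?I. A S) \<inter> set_pmf ?M)"
    by (simp add: measure_Int_set_pmf)
  also have "\<dots> \<le> measure_pmf.prob ?M {G. finite (vertices G) \<and> cliques G k \<noteq> {}}"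
  proof (rule measure_pmf.finite_measure_mono)
    show "(\<Union>S\<in>?I. A S) \<inter> set_pmf ?M \<subseteq> {G. finite (vertices G) \<and> cliques G k \<noteq> {}}"
    proof
      fix G assume "G \<in> (\<Union>S\<in>?I. A S) \<inter> set_pmf ?M"
      then obtain S where S: "S \<in> ?I" "possible_edges S \<subseteq> edges G" and V: "vertices G = {1..n}"
        using simple_graph_erdos_renyi by (auto simp: A_def)
      then have "S \<in> cliques G k"
        using fin[OF S(1)] by (simp add: cliques_eq)
      then show "G \<in> {G. finite (vertices G) \<and> cliques G k \<noteq> {}}"
        using V by auto
    qed
  qed simp
  finally show ?thesis .
qed

text \<open>Independence squares the bound for one graph. By \<open>small\<close> the bound is
  nonnegative, so squaring preserves the inequality.\<close>

lemma prob_tensor_product_clique_ge: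
  assumes p: "0 < p" "p < 1" and k: "k \<le> n"
  assumes small: "(1 + sqrt (1 / p) ^ k * real k / real n) ^ k \<le> 2"
  shows "(2 - (1 + sqrt (1 / p) ^ k * real k / real n) ^ k)\<^sup>2
    \<le> measure_pmf.prob (pair_pmf (erdos_renyi n p) (erdos_renyi n p))
         {(G, H). 0 < card (cliques (tensor_product G H) k)}"
proof -
  let ?M = "erdos_renyi n p"
  let ?A = "{G :: nat ugraph. finite (vertices G) \<and> cliques G k \<noteq> {}}"
  have fin: "finite (cliques (tensor_product G H) k)"
    if "finite (vertices G)" "finite (vertices H)" for G H :: "nat ugraph"
    by (rule finite_subset[of _ "Pow (vertices G \<times> vertices H)"])
       (use that in \<open>auto simp: cliques_def tensor_product_def\<close>)
  have "(2 - (1 + sqrt (1 / p) ^ k * real k / real n) ^ k)\<^sup>2 \<le> (measure_pmf.prob ?M ?A)\<^sup>2"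
    using prob_erdos_renyi_clique_ge[OF p k] small by (intro power_mono) auto
  also have "\<dots> = measure_pmf.prob (pair_pmf ?M ?M) (?A \<times> ?A)"
    by (simp add: prob_pair_pmf_Times power2_eq_square)
  also have "\<dots> \<le> measure_pmf.prob (pair_pmf ?M ?M) {(G, H). 0 < card (cliques (tensor_product G H) k)}"
  proof (rule measure_pmf.finite_measure_mono)
    show "?A \<times> ?A \<subseteq> {(G, H). 0 < card (cliques (tensor_product G H) k)}"
    proof clarify
      fix G H :: "nat ugraph"
      assume "finite (vertices G)" "cliques G k \<noteq> {}" "finite (vertices H)" "cliques H k \<noteq> {}"
      then show "0 < card (cliques (tensor_product G H) k)"
        unfolding card_gt_0_iff by (intro conjI fin cliques_tensor_product_nonempty)
    qed
  qed simp
  finally show ?thesis .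
qed

section \<open>Choice of \<open>k\<close> and asymptotics\<close>

theorem theorem3p2:
  fixes p :: real
  assumes "0 < p" and "p < 1"
  shows "\<exists>(a :: nat \<Rightarrow> real) (k :: nat \<Rightarrow> nat).
    (\<forall>n. 0 \<le> a n) \<and> a \<in> o(\<lambda>_. 1) \<and>
    (\<forall>\<^sub>F n in sequentially. 0 < k n \<and> real (k n) = (2 - a n) * log (1 / p) (real n)) \<and>
    (\<lambda>n. measure_pmf.prob (pair_pmf (erdos_renyi n p) (erdos_renyi n p))
           {(G, H). 0 < card (cliques (tensor_product G H) (k n))}) \<longlonglongrightarrow> 1"
proof -
  define c where "c = ln (1 / p)"
  have c: "c > 0"
    using assms by (simp add: c_def)
  define L where "L = (\<lambda>n::nat. ln (real n) / c)"
  have L_eq: "L n = log (1 / p) (real n)" for n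
    by (simp add: L_def c_def log_def)
  define k where "k = (\<lambda>n. nat \<lfloor>2 * L n - sqrt (L n)\<rfloor>)"
  \<comment> \<open>Obtained by solving the required equation for \<open>a n\<close>. Where
    \<open>L n = 0\<close>, division by zero makes \<open>a n = 2\<close>, still
    nonnegative.\<close>
  define a where "a = (\<lambda>n. 2 - real (k n) / L n)"
  have L_nonneg: "L n \<ge> 0" for n
    using c by (cases n) (auto simp: L_def)
  have L_top: "filterlim L at_top sequentially"
    unfolding L_def using c by real_asymp
  \<comment> \<open>Holds for every \<open>n\<close>: if the floor is negative, \<open>nat\<close>
    returns 0, and \<open>L n\<close> is nonnegative.\<close>
  have k_le: "real (k n) \<le> 2 * L n" for n
    using L_nonneg[of n] by (auto simp: k_def) (smt (verit) of_int_floor_le of_nat_nat real_sqrt_ge_zero of_nat_0 nat_eq_iff2 linorder_not_less floor_less_iff)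
  \<comment> \<open>Beyond 4, \<open>sqrt (L n) \<le> L n / 2\<close>, so
    \<open>2 * L n - sqrt (L n)\<close> exceeds 6; then \<open>nat\<close> truncates nothing and
    \<open>k n\<close> is positive.\<close>
  have large: "\<forall>\<^sub>F n in sequentially. L n > 4"
    using L_top by (simp add: filterlim_at_top_dense)
  have k_bounds: "real (k n) \<le> 2 * L n - sqrt (L n)" "2 * L n - sqrt (L n) - 1 < real (k n)" "1 < real (k n)"
    if "L n > 4" for n
  proof -
    have "sqrt (L n) \<le> L n / 2"
      using that by (intro real_le_lsqrt) (auto simp: power2_eq_square field_simps)
    then have "2 * L n - sqrt (L n) \<ge> 3 / 2 * L n"
      by linarith
    then show "real (k n) \<le> 2 * L n - sqrt (L n)" "2 * L n - sqrt (L n) - 1 < real (k n)" "1 < real (k n)"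
      using that unfolding k_def by linarith+
  qed
  have a_nonneg: "0 \<le> a n" for n
    using k_le[of n] L_nonneg[of n] unfolding a_def by (cases "L n = 0") (auto simp: field_simps)
  have "a \<longlonglongrightarrow> 0"
  proof (rule tendsto_sandwich[OF _ _ tendsto_const])
    \<comment> \<open>The summand 1 pays for rounding down in \<open>k n\<close>.\<close>
    show "\<forall>\<^sub>F n in sequentially. a n \<le> (sqrt (L n) + 1) / L n"
      using large
    proof eventually_elim
      case (elim n)
      then have "2 * L n - real (k n) \<le> sqrt (L n) + 1"
        using k_bounds(2)[of n] by linarith
      then show ?case
        using elim by (simp add: a_def divide_simps)
    qed
    have "((\<lambda>x::real. (sqrt x + 1) / x) \<longlongrightarrow> 0) at_top"
      by real_asymp
    then show "(\<lambda>n. (sqrt (L n) + 1) / L n) \<longlonglongrightarrow> 0"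
      by (rule filterlim_compose[OF _ L_top])
  qed (use a_nonneg in auto)
  then have a_small: "a \<in> o(\<lambda>_. 1)"
    by (intro smalloI_tendsto) auto
  have k_eq: "\<forall>\<^sub>F n in sequentially. 0 < k n \<and> real (k n) = (2 - a n) * log (1 / p) (real n)"
    using large
  proof eventually_elim
    case (elim n)
    then show ?case
      using k_bounds(3)[of n] unfolding L_eq[symmetric] by (simp add: a_def)
  qed
  define r where "r = (\<lambda>n. (1 + sqrt (1 / p) ^ k n * real (k n) / real n) ^ k n)"
  have r_bounds: "\<forall>\<^sub>F n in sequentially. 1 \<le> r n \<and> r n \<le> exp (4 * (L n)\<^sup>2 * exp (- (c * sqrt (L n) / 2)))"
    using large eventually_gt_at_top[of 0]
  proof eventually_elim
    case (elim n)
    let ?x = "sqrt (1 / p) ^ k n * real (k n) / real n"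
    have x0: "?x \<ge> 0"
      using assms by simp
    have n_eq: "real n = exp (c * L n)"
      using elim c by (simp add: L_def)
    have "sqrt (1 / p) = exp (c / 2)"
      using assms unfolding c_def by (simp add: real_sqrt_unique power2_eq_square flip: exp_add)
    then have "sqrt (1 / p) ^ k n = exp (real (k n) * (c / 2))"
      by (simp only: exp_of_nat_mult)
    \<comment> \<open>The part \<open>2 * L n\<close> yields exactly \<open>n\<close>, cancelling
      the denominator; the subtracted \<open>sqrt (L n)\<close> leaves the decaying factor.\<close>
    also have "\<dots> \<le> exp ((2 * L n - sqrt (L n)) * (c / 2))"
      using k_bounds(1)[OF elim(1)] c by simp
    also have "\<dots> = real n * exp (- (c * sqrt (L n) / 2))"
      unfolding n_eq exp_add[symmetric] by (simp add: field_simps)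
    finally have s_le: "sqrt (1 / p) ^ k n / real n \<le> exp (- (c * sqrt (L n) / 2))"
      using elim by (simp add: field_simps)
    have "real (k n) * ?x = (real (k n))\<^sup>2 * (sqrt (1 / p) ^ k n / real n)"
      by (simp add: power2_eq_square)
    also have "\<dots> \<le> (2 * L n)\<^sup>2 * exp (- (c * sqrt (L n) / 2))"
      using s_le k_le[of n] assms by (intro mult_mono power_mono) auto
    finally have kx: "real (k n) * ?x \<le> 4 * (L n)\<^sup>2 * exp (- (c * sqrt (L n) / 2))"
      by (simp add: power_mult_distrib)
    \<comment> \<open>From 1 + x \<le> exp x.\<close>
    have "r n \<le> exp ?x ^ k n"
      unfolding r_def using x0 by (intro power_mono) auto
    also have "\<dots> = exp (real (k n) * ?x)"
      by (simp only: exp_of_nat_mult)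
    also have "\<dots> \<le> exp (4 * (L n)\<^sup>2 * exp (- (c * sqrt (L n) / 2)))"
      using kx by simp
    finally show ?case
      using x0 by (simp add: r_def one_le_power)
  qed
  have r_lim: "r \<longlonglongrightarrow> 1"
  proof (rule tendsto_sandwich[OF _ _ tendsto_const])
    have "((\<lambda>x::real. exp (4 * x\<^sup>2 * exp (- (c * sqrt x / 2)))) \<longlongrightarrow> 1) at_top"
      using c by real_asymp
    then show "(\<lambda>n. exp (4 * (L n)\<^sup>2 * exp (- (c * sqrt (L n) / 2)))) \<longlonglongrightarrow> 1"
      by (rule filterlim_compose[OF _ L_top])
  qed (use r_bounds in \<open>auto elim: eventually_mono\<close>)
  let ?P = "\<lambda>n. measure_pmf.prob (pair_pmf (erdos_renyi n p) (erdos_renyi n p))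
           {(G, H). 0 < card (cliques (tensor_product G H) (k n))}"
  have "?P \<longlonglongrightarrow> 1"
  proof (rule tendsto_sandwich[OF _ _ _ tendsto_const])
    \<comment> \<open>This supplies the hypothesis \<open>small\<close>; the next bound, with
      \<open>k_le\<close>, supplies \<open>k n \<le> n\<close>.\<close>
    have "\<forall>\<^sub>F n in sequentially. r n < 2"
      using r_lim by (rule order_tendstoD) simp
    moreover have "\<forall>\<^sub>F n in sequentially. 2 * L n \<le> real n"
      unfolding L_def using c by real_asymp
    ultimately show "\<forall>\<^sub>F n in sequentially. (2 - r n)\<^sup>2 \<le> ?P n"
    proof eventually_elim
      case (elim n)
      then have "k n \<le> n"
        using k_le[of n] by linarith
      then show ?case
        using prob_tensor_product_clique_ge[OF assms, of "k n" n] elim by (simp add: r_def)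
    qed
    have "(\<lambda>n. (2 - r n)\<^sup>2) \<longlonglongrightarrow> (2 - 1)\<^sup>2"
      by (intro tendsto_intros r_lim)
    then show "(\<lambda>n. (2 - r n)\<^sup>2) \<longlonglongrightarrow> 1"
      by simp
  qed (simp add: measure_pmf.prob_le_1)
  then show ?thesis
    using a_nonneg a_small k_eq by blast
qed

end
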